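(* Helical surfaces with constant ratio $a$ of principal curvatures possess singular curves for $a>0$. More precisely, let $k=\left|\frac{a-1}{a+1}\right|$, let $C>0$ be a constant, put $$h(s)=\frac{2Cs^{k+1}}{s^2+1},\qquad I_C=\{s>0:\ h(s)>1\},$$ $$g(s)=\frac{(k-1)s^2-(k+1)}{4ks}\sqrt{h(s)},\qquad t(s)=\sqrt{h(s)-1},\qquad X_0(s)=\left(\frac{t(s)}{2},\ g(s),\ \int\frac{g'(s)}{t(s)}\,ds\right).$$ Then $$X_0'(s)=h'(s)\left(\frac{1}{4t(s)},\ \frac{(k+1)s^2-k+1}{8ks\sqrt{h(s)}},\ \frac{(k+1)s^2-k+1}{8ks\,t(s)\sqrt{h(s)}}\right),\qquad h'(s)=\frac{2Cs^k\big((k-1)s^2+1+k\big)}{(s^2+1)^2},$$ so that the coordinates of $X_0'(s)$ have the common factor $(k-1)s^2+1+k$. Thus a cusp of $X_0$ occurs only if $s=s_k=\sqrt{\frac{1+k}{1-k}}$, in which case $k<1$ (i.e. $a>0$). In this case $t(s)$ admits a maximum at $s=s_k$ and then decreases till $t(s_0')=0$ for some $s_0'>s_k>s_0$, where $s_0=\inf I_C$. Under the helical motion $(x_0,y_0,z_0)\mapsto\left(x_0\cos v-y_0\sin v,\ x_0\sin v+y_0\cos v,\ z_0+\frac v2\right)$, $v\in\mathbb{R}$, the point $X_0(s_k)$ generates a singular curve which separates the helical surface into two parts.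
   Context: The setting is helical surfaces in Euclidean $\mathbb{R}^3$ with axis the $z$-axis and pitch $1/2$ whose principal curvatures have constant ratio $a=\kappa_1/\kappa_2$, with $a\notin\{0,1,-1\}$ (developable and minimal surfaces are excluded, and $a=1$ does not occur for helical surfaces). Such a surface is generated under the stated helical motion by the profile curve $X_0(s)$, $s\in I_C$. The constant $C$ is assumed large enough that $I_C$ is nonempty, and the integral denotes an antiderivative, with free additive constant. The case $k<1$ corresponds to $a>0$ (positive Gaussian curvature), the case $k>1$ to $a<0$. *)

theory Defs
  imports "HOL-Analysis.Analysis" "HOL-Analysis.Cross3"
begin

section \<open>Parametrized surfaces in Euclidean 3-space\<close>

definition regular_point :: "(real \<times> real \<Rightarrow> real ^ 3) \<Rightarrow> real \<times> real \<Rightarrow> bool" where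
  "regular_point F p \<longleftrightarrow> (\<exists>D. (F has_derivative D) (at p) \<and> inj D)"

definition singular_point :: "(real \<times> real \<Rightarrow> real ^ 3) \<Rightarrow> real \<times> real \<Rightarrow> bool" where
  "singular_point F p \<longleftrightarrow> (\<exists>D. (F has_derivative D) (at p) \<and> \<not> inj D)"

definition partial1 :: "(real \<times> real \<Rightarrow> real ^ 3) \<Rightarrow> real \<times> real \<Rightarrow> real ^ 3" where
  "partial1 F p = vector_derivative (\<lambda>s. F (s, snd p)) (at (fst p))"

definition partial2 :: "(real \<times> real \<Rightarrow> real ^ 3) \<Rightarrow> real \<times> real \<Rightarrow> real ^ 3" where
  "partial2 F p = vector_derivative (\<lambda>v. F (fst p, v)) (at (snd p))"

definition unit_normal :: "(real \<times> real \<Rightarrow> real ^ 3) \<Rightarrow> real \<times> real \<Rightarrow> real ^ 3" where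
  "unit_normal F p = sgn (cross3 (partial1 F p) (partial2 F p))"

text \<open>The eigenvalues of the shape operator, i.e. of the second fundamental form
  relative to the first one. Only meaningful at regular points.\<close>

definition principal_curvature :: "(real \<times> real \<Rightarrow> real ^ 3) \<Rightarrow> real \<times> real \<Rightarrow> real \<Rightarrow> bool" where
  "principal_curvature F p \<kappa> \<longleftrightarrow>
    (let E = partial1 F p \<bullet> partial1 F p;
         M = partial1 F p \<bullet> partial2 F p;
         G = partial2 F p \<bullet> partial2 F p;
         e = partial1 (partial1 F) p \<bullet> unit_normal F p;
         m = partial1 (partial2 F) p \<bullet> unit_normal F p;
         g = partial2 (partial2 F) p \<bullet> unit_normal F p
     in \<exists>\<xi> \<eta>. (\<xi>, \<eta>) \<noteq> (0, 0) \<and>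
          e * \<xi> + m * \<eta> = \<kappa> * (E * \<xi> + M * \<eta>) \<and>
          m * \<xi> + g * \<eta> = \<kappa> * (M * \<xi> + G * \<eta>))"

definition principal_curvature_ratio :: "(real \<times> real \<Rightarrow> real ^ 3) \<Rightarrow> real \<times> real \<Rightarrow> real \<Rightarrow> bool" where
  "principal_curvature_ratio F p a \<longleftrightarrow>
    (\<exists>\<kappa>1 \<kappa>2. {\<kappa>. principal_curvature F p \<kappa>} = {\<kappa>1, \<kappa>2} \<and> \<kappa>2 \<noteq> 0 \<and> \<kappa>1 / \<kappa>2 = a)"

section \<open>Cusps of parametrized curves\<close>

text \<open>A singular point of a curve at which the direction of the tangent is reversed.\<close>

definition cusp_at :: "(real \<Rightarrow> 'a :: real_normed_vector) \<Rightarrow> real \<Rightarrow> bool" where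
  "cusp_at \<gamma> s \<longleftrightarrow>
    (\<gamma> has_vector_derivative 0) (at s) \<and>
    (\<forall>\<^sub>F r in at s. \<gamma> differentiable (at r)) \<and>
    (\<exists>u. norm u = 1 \<and>
       ((\<lambda>r. sgn (vector_derivative \<gamma> (at r))) \<longlongrightarrow> u) (at_left s) \<and>
       ((\<lambda>r. sgn (vector_derivative \<gamma> (at r))) \<longlongrightarrow> - u) (at_right s))"

section \<open>Helical surfaces\<close>

definition helical_motion :: "real \<Rightarrow> real ^ 3 \<Rightarrow> real ^ 3" where
  "helical_motion v p =
     vector [p $ 1 * cos v - p $ 2 * sin v, p $ 1 * sin v + p $ 2 * cos v, p $ 3 + v / 2]"

definition helical_surface :: "(real \<Rightarrow> real ^ 3) \<Rightarrow> real \<times> real \<Rightarrow> real ^ 3" where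
  "helical_surface \<gamma> = (\<lambda>(s, v). helical_motion v (\<gamma> s))"

definition h_fun :: "real \<Rightarrow> real \<Rightarrow> real \<Rightarrow> real" where
  "h_fun k C s = 2 * C * s powr (k + 1) / (s\<^sup>2 + 1)"

definition I_dom :: "real \<Rightarrow> real \<Rightarrow> real set" where
  "I_dom k C = {s. s > 0 \<and> h_fun k C s > 1}"

definition g_fun :: "real \<Rightarrow> real \<Rightarrow> real \<Rightarrow> real" where
  "g_fun k C s = ((k - 1) * s\<^sup>2 - (k + 1)) / (4 * k * s) * sqrt (h_fun k C s)"

definition t_fun :: "real \<Rightarrow> real \<Rightarrow> real \<Rightarrow> real" where
  "t_fun k C s = sqrt (h_fun k C s - 1)"

text \<open>The third coordinate is a parameter \<open>z\<close>, to be instantiated by an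
  antiderivative of \<open>g' / t\<close> on \<^term>\<open>I_dom k C\<close>.\<close>

definition profile :: "real \<Rightarrow> real \<Rightarrow> (real \<Rightarrow> real) \<Rightarrow> real \<Rightarrow> real ^ 3" where
  "profile k C z s = vector [t_fun k C s / 2, g_fun k C s, z s]"

end

theory Submission
  imports Defs
begin

text \<open>The velocity of the profile is \<open>h'\<close> times the vector
  \<open>(1/(4t), P, P/t)\<close> with \<open>P = g'/h'\<close>, whose first entry never vanishes on the
  domain. So singular points are exactly the zeros of \<open>h'\<close>, that is of
  \<open>(k - 1) s\<^sup>2 + 1 + k\<close>, and the only possible one is \<open>sk\<close>, with
  \<open>k < 1\<close>. There \<open>h'\<close> passes from positive to negative, so the unit tangent has
  opposite limits on the two sides, which is a cusp (\<open>cusp_atI\<close>). Moreover \<open>h\<close>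
  increases up to \<open>sk\<close> and decreases to \<open>0\<close> afterwards, which makes the domain a
  bounded interval around \<open>sk\<close> and gives the behaviour of \<open>t\<close>
  (\<open>I_dom_interval\<close>).

  For the curvature ratio, equivariance reduces the fundamental forms to the profile
  (\<open>helical_surface_principal_curvature\<close>). The normal is proportional to
  \<open>(0, -1, t)\<close>, rotated. With \<open>Q = P g + 1/8\<close> and \<open>T = P h - g/2\<close> the
  explicit formulas for \<open>Q\<close> and \<open>T\<close> give
  \<open>(1 - k\<^sup>2) T\<^sup>2 = - 2 h Q\<close>, hence the discriminant of the
  characteristic equation is a square and the principal curvatures are a common multiple of
  \<open>1 + k\<close> and \<open>1 - k\<close> (\<open>helical_principal_curvatures\<close>). The number
  \<open>a\<close> is one of the two quotients of these.

  That the helix through the cusp separates the surface requires that it meets neither of the two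
  parts. The reason is that the same quantity \<open>Q\<close>, negative for \<open>k < 1\<close>, controls
  the distance to the axis: the derivative of its square is \<open>2 h' Q\<close>, so the distance
  is strictly minimal at \<open>sk\<close> (\<open>profile_axis_distance_minimal\<close>), while helical
  motions preserve it.\<close>

section \<open>Differential geometry of helical surfaces\<close>

definition rot :: "real \<Rightarrow> real ^ 3 \<Rightarrow> real ^ 3" where
  "rot v p = vector [p $ 1 * cos v - p $ 2 * sin v, p $ 1 * sin v + p $ 2 * cos v, p $ 3]"

definition quarter_turn :: "real ^ 3 \<Rightarrow> real ^ 3" where
  "quarter_turn p = vector [- p $ 2, p $ 1, 0]"

definition helical_velocity :: "real ^ 3 \<Rightarrow> real ^ 3" where
  "helical_velocity p = vector [- p $ 2, p $ 1, 1 / 2]"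

lemma vector_3_eq_axis:
  "vector [a, b, c] = a *\<^sub>R axis 1 1 + b *\<^sub>R axis 2 1 + c *\<^sub>R (axis 3 1 :: real ^ 3)"
  by (simp add: vec_eq_iff forall_3 axis_def)

lemma inner_3: "x \<bullet> y = x $ 1 * y $ 1 + x $ 2 * y $ 2 + x $ 3 * y $ 3" for x y :: "real ^ 3"
  by (simp add: inner_vec_def sum_3)

lemma has_vector_derivative_vector_3 [derivative_intros]:
  fixes f1 f2 f3 :: "real \<Rightarrow> real"
  assumes "(f1 has_real_derivative d1) (at x)" "(f2 has_real_derivative d2) (at x)"
    "(f3 has_real_derivative d3) (at x)"
  shows "((\<lambda>x. vector [f1 x, f2 x, f3 x] :: real ^ 3) has_vector_derivative vector [d1, d2, d3]) (at x)"
  unfolding vector_3_eq_axis by (auto intro!: derivative_eq_intros assms)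

lemma linear_rot: "linear (rot v)"
  by (rule linearI) (simp_all add: rot_def vec_eq_iff forall_3 algebra_simps)

lemma rot_scaleR: "rot v (c *\<^sub>R p) = c *\<^sub>R rot v p"
  by (rule linear_scale[OF linear_rot])

lemma bounded_linear_rot: "bounded_linear (rot v)"
  using linear_rot linear_conv_bounded_linear by blast

text \<open>Rotations preserve inner and cross products, so all invariants of a helical surface at
  \<open>(s, v)\<close> agree with those at \<open>(s, 0)\<close> and depend on the profile curve alone.\<close>

lemma rot_inner [simp]: "rot v p \<bullet> rot v q = p \<bullet> q"
proof -
  have "rot v p \<bullet> rot v q = (p $ 1 * q $ 1 + p $ 2 * q $ 2) * ((cos v)\<^sup>2 + (sin v)\<^sup>2) + p $ 3 * q $ 3"
    unfolding inner_3 rot_def vector_3 by algebra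
  then show ?thesis by (simp add: inner_3)
qed

lemma rot_norm [simp]: "norm (rot v p) = norm p"
  by (simp add: norm_eq_sqrt_inner)

lemma rot_cross: "cross3 (rot v p) (rot v q) = rot v (cross3 p q)"
proof -
  have cs: "(cos v)\<^sup>2 + (sin v)\<^sup>2 = 1" by simp
  have "(p $ 1 * cos v - p $ 2 * sin v) * (q $ 1 * sin v + q $ 2 * cos v)
     - (p $ 1 * sin v + p $ 2 * cos v) * (q $ 1 * cos v - q $ 2 * sin v)
     = (p $ 1 * q $ 2 - p $ 2 * q $ 1) * ((cos v)\<^sup>2 + (sin v)\<^sup>2)"
    by algebra
  then show ?thesis
    by (simp add: cross3_def rot_def vec_eq_iff forall_3 algebra_simps)
qed

lemma rot_sgn: "sgn (rot v p) = rot v (sgn p)"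
  by (simp add: sgn_div_norm rot_scaleR)

lemma rot_has_vector_derivative:
  "((\<lambda>v. rot v p) has_vector_derivative rot v (quarter_turn p)) (at v)"
  unfolding rot_def quarter_turn_def
  by (auto intro!: derivative_eq_intros simp: vec_eq_iff forall_3)

lemma helical_motion_eq_rot: "helical_motion v p = rot v p + (v / 2) *\<^sub>R axis 3 1"
  by (simp add: helical_motion_def rot_def vec_eq_iff forall_3 axis_def)

lemma rot_helical_velocity:
  "rot v (helical_velocity p) = rot v (quarter_turn p) + (1 / 2) *\<^sub>R axis 3 1"
  by (simp add: helical_velocity_def quarter_turn_def rot_def vec_eq_iff forall_3 axis_def)

lemma helical_surface_partial1:
  assumes "(\<gamma> has_vector_derivative \<gamma>') (at s)"
  shows "((\<lambda>s. helical_surface \<gamma> (s, v)) has_vector_derivative rot v \<gamma>') (at s)"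
proof -
  have "((\<lambda>s. rot v (\<gamma> s)) has_vector_derivative rot v \<gamma>') (at s)"
    by (rule bounded_linear.has_vector_derivative[OF bounded_linear_rot assms])
  then show ?thesis
    by (simp add: helical_surface_def helical_motion_eq_rot has_vector_derivative_add_const)
qed

lemma helical_surface_partial2:
  "((\<lambda>v. helical_surface \<gamma> (s, v)) has_vector_derivative rot v (helical_velocity (\<gamma> s))) (at v)"
  unfolding helical_surface_def helical_motion_eq_rot split_conv rot_helical_velocity
  by (auto intro!: derivative_eq_intros rot_has_vector_derivative)

lemma helical_surface_has_derivative:
  assumes "(\<gamma> has_vector_derivative \<gamma>') (at s)"
  shows "(helical_surface \<gamma> has_derivative
    (\<lambda>(a, b). a *\<^sub>R rot v \<gamma>' + b *\<^sub>R rot v (helical_velocity (\<gamma> s)))) (at (s, v))"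
proof -
  have "((\<lambda>p. \<gamma> (fst p)) has_derivative (\<lambda>p. fst p *\<^sub>R \<gamma>')) (at (s, v))"
    using has_derivative_compose[of fst fst "(s, v)" UNIV \<gamma> "\<lambda>a. a *\<^sub>R \<gamma>'"] assms
    by (auto simp: has_vector_derivative_def bounded_linear_imp_has_derivative bounded_linear_fst)
  then have co: "((\<lambda>p. \<gamma> (fst p) $ i) has_derivative (\<lambda>p. fst p * \<gamma>' $ i)) (at (s, v))" for i
    using bounded_linear.has_derivative[OF bounded_linear_vec_nth] by fastforce
  have c: "((\<lambda>p. cos (snd p)) has_derivative (\<lambda>p. - sin v * snd p)) (at (s, v))"
    by (auto intro!: derivative_eq_intros simp: mult.commute)
  have d: "((\<lambda>p. sin (snd p)) has_derivative (\<lambda>p. cos v * snd p)) (at (s, v))"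
    by (auto intro!: derivative_eq_intros simp: mult.commute)
  have "((\<lambda>p. vector [\<gamma> (fst p) $ 1 * cos (snd p) - \<gamma> (fst p) $ 2 * sin (snd p),
        \<gamma> (fst p) $ 1 * sin (snd p) + \<gamma> (fst p) $ 2 * cos (snd p), \<gamma> (fst p) $ 3 + snd p / 2] :: real ^ 3)
      has_derivative (\<lambda>p. vector [
        \<gamma> s $ 1 * (- sin v * snd p) + fst p * \<gamma>' $ 1 * cos v
          - (\<gamma> s $ 2 * (cos v * snd p) + fst p * \<gamma>' $ 2 * sin v),
        \<gamma> s $ 1 * (cos v * snd p) + fst p * \<gamma>' $ 1 * sin v
          + (\<gamma> s $ 2 * (- sin v * snd p) + fst p * \<gamma>' $ 2 * cos v),
        fst p * \<gamma>' $ 3 + snd p / 2])) (at (s, v))"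
    unfolding vector_3_eq_axis
    using has_derivative_mult[OF co c] has_derivative_mult[OF co d]
    by (intro has_derivative_add has_derivative_diff has_derivative_scaleR_left co
          bounded_linear_imp_has_derivative
          bounded_linear_compose[OF bounded_linear_divide bounded_linear_snd]) simp_all
  moreover have "(\<lambda>(a, b). a *\<^sub>R rot v \<gamma>' + b *\<^sub>R rot v (helical_velocity (\<gamma> s))) = (\<lambda>p. vector [
        \<gamma> s $ 1 * (- sin v * snd p) + fst p * \<gamma>' $ 1 * cos v
          - (\<gamma> s $ 2 * (cos v * snd p) + fst p * \<gamma>' $ 2 * sin v),
        \<gamma> s $ 1 * (cos v * snd p) + fst p * \<gamma>' $ 1 * sin v
          + (\<gamma> s $ 2 * (- sin v * snd p) + fst p * \<gamma>' $ 2 * cos v),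
        fst p * \<gamma>' $ 3 + snd p / 2])"
    by (simp add: fun_eq_iff vec_eq_iff forall_3 rot_def helical_velocity_def algebra_simps)
  ultimately show ?thesis
    by (simp add: helical_surface_def helical_motion_def case_prod_beta')
qed

lemma helical_surface_continuous:
  assumes "isCont \<gamma> s"
  shows "isCont (\<lambda>s. helical_surface \<gamma> (s, v)) s"
  unfolding helical_surface_def helical_motion_eq_rot split_conv
  by (intro continuous_intros bounded_linear.isCont[OF bounded_linear_rot] assms)

text \<open>The cross product detects linear independence of the two partial derivatives, hence
  injectivity of the differential.\<close>

lemma helical_surface_regular_point:
  assumes "(\<gamma> has_vector_derivative \<gamma>') (at s)" "cross3 \<gamma>' (helical_velocity (\<gamma> s)) \<noteq> 0"
  shows "regular_point (helical_surface \<gamma>) (s, v)"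
proof -
  let ?D = "\<lambda>(a, b). a *\<^sub>R rot v \<gamma>' + b *\<^sub>R rot v (helical_velocity (\<gamma> s))"
  have hd: "(helical_surface \<gamma> has_derivative ?D) (at (s, v))"
    by (rule helical_surface_has_derivative[OF assms(1)])
  have "a = 0 \<and> b = 0" if 0: "?D (a, b) = 0" for a b
  proof -
    let ?w = "helical_velocity (\<gamma> s)"
    have "rot v (a *\<^sub>R \<gamma>' + b *\<^sub>R ?w) = 0"
      using 0 by (simp add: linear_add[OF linear_rot] rot_scaleR)
    then have z: "a *\<^sub>R \<gamma>' + b *\<^sub>R ?w = 0" by (metis norm_eq_zero rot_norm)
    have "cross3 (a *\<^sub>R \<gamma>' + b *\<^sub>R ?w) ?w = a *\<^sub>R cross3 \<gamma>' ?w"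
      "cross3 \<gamma>' (a *\<^sub>R \<gamma>' + b *\<^sub>R ?w) = b *\<^sub>R cross3 \<gamma>' ?w"
      by (simp_all add: cross3_def vec_eq_iff forall_3 algebra_simps)
    then have "a *\<^sub>R cross3 \<gamma>' ?w = 0" "b *\<^sub>R cross3 \<gamma>' ?w = 0"
      unfolding z by simp_all
    with assms(2) show ?thesis by simp
  qed
  then have "inj ?D"
    by (auto simp: linear_injective_0[OF has_derivative_linear[OF hd]] zero_prod_def)
  with hd show ?thesis unfolding regular_point_def by blast
qed

lemma helical_surface_singular_point:
  assumes "(\<gamma> has_vector_derivative 0) (at s)"
  shows "singular_point (helical_surface \<gamma>) (s, v)"
proof -
  let ?D = "\<lambda>(a, b). a *\<^sub>R rot v 0 + b *\<^sub>R rot v (helical_velocity (\<gamma> s))"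
  have "?D (1, 0) = ?D (0, 0)" by (simp add: linear_0[OF linear_rot])
  then have "\<not> inj ?D" unfolding inj_def by (metis prod.inject zero_neq_one)
  then show ?thesis
    using helical_surface_has_derivative[OF assms] unfolding singular_point_def by blast
qed

lemma regular_point_not_singular: "regular_point F p \<Longrightarrow> \<not> singular_point F p"
  unfolding regular_point_def singular_point_def using has_derivative_unique by blast

text \<open>By equivariance under the helical motion the first and second fundamental forms can be
  computed in the rotated frame: differentiation in the angle acts there as the quarter turn about
  the axis. This reduces principal curvatures to algebra in the profile \<open>\<gamma>\<close> and
  its first two derivatives.\<close>

lemma helical_surface_principal_curvature:
  assumes U: "open U" "s \<in> U"
    and d1: "\<forall>u\<in>U. (\<gamma> has_vector_derivative \<gamma>1 u) (at u)"
    and d2: "(\<gamma>1 has_vector_derivative \<gamma>2) (at s)"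
    and n: "n = sgn (cross3 (\<gamma>1 s) (helical_velocity (\<gamma> s)))"
  shows "principal_curvature (helical_surface \<gamma>) (s, v) \<kappa> \<longleftrightarrow>
    (\<exists>\<xi> \<eta>. (\<xi>, \<eta>) \<noteq> (0, 0) \<and>
       (\<gamma>2 \<bullet> n) * \<xi> + (quarter_turn (\<gamma>1 s) \<bullet> n) * \<eta>
         = \<kappa> * ((\<gamma>1 s \<bullet> \<gamma>1 s) * \<xi> + (\<gamma>1 s \<bullet> helical_velocity (\<gamma> s)) * \<eta>) \<and>
       (quarter_turn (\<gamma>1 s) \<bullet> n) * \<xi> + (quarter_turn (helical_velocity (\<gamma> s)) \<bullet> n) * \<eta>
         = \<kappa> * ((\<gamma>1 s \<bullet> helical_velocity (\<gamma> s)) * \<xi>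
              + (helical_velocity (\<gamma> s) \<bullet> helical_velocity (\<gamma> s)) * \<eta>))"
proof -
  let ?F = "helical_surface \<gamma>"
  have p1: "partial1 ?F (u, v) = rot v (\<gamma>1 u)" if "u \<in> U" for u v
    unfolding partial1_def using helical_surface_partial1[OF d1[rule_format, OF that]]
    by (simp add: vector_derivative_at)
  have p2: "partial2 ?F (u, v) = rot v (helical_velocity (\<gamma> u))" for u v
    unfolding partial2_def using helical_surface_partial2
    by (simp add: vector_derivative_at)
  have "((\<lambda>u. rot v (\<gamma>1 u)) has_vector_derivative rot v \<gamma>2) (at s)"
    by (rule bounded_linear.has_vector_derivative[OF bounded_linear_rot d2])
  then have "((\<lambda>u. partial1 ?F (u, v)) has_vector_derivative rot v \<gamma>2) (at s)"
    by (rule has_vector_derivative_transform_within_open[OF _ U]) (simp add: p1)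
  then have p11: "partial1 (partial1 ?F) (s, v) = rot v \<gamma>2"
    unfolding partial1_def[of "partial1 ?F"] by (simp add: vector_derivative_at)
  have "((\<lambda>u. quarter_turn (\<gamma> u)) has_vector_derivative quarter_turn (\<gamma>1 s)) (at s)"
  proof (rule bounded_linear.has_vector_derivative[OF _ d1[rule_format, OF U(2)]])
    have "linear quarter_turn"
      by (rule linearI) (simp_all add: quarter_turn_def vec_eq_iff forall_3)
    then show "bounded_linear quarter_turn" using linear_conv_bounded_linear by blast
  qed
  from bounded_linear.has_vector_derivative[OF bounded_linear_rot this]
  have "((\<lambda>u. partial2 ?F (u, v)) has_vector_derivative rot v (quarter_turn (\<gamma>1 s))) (at s)"
    by (simp add: p2 rot_helical_velocity has_vector_derivative_add_const)
  then have p12: "partial1 (partial2 ?F) (s, v) = rot v (quarter_turn (\<gamma>1 s))"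
    unfolding partial1_def by (simp add: vector_derivative_at)
  have "((\<lambda>v. partial2 ?F (s, v)) has_vector_derivative
      rot v (quarter_turn (helical_velocity (\<gamma> s)))) (at v)"
    unfolding p2 by (rule rot_has_vector_derivative)
  then have p22: "partial2 (partial2 ?F) (s, v) = rot v (quarter_turn (helical_velocity (\<gamma> s)))"
    unfolding partial2_def[of "partial2 ?F"] by (simp add: vector_derivative_at)
  have un: "unit_normal ?F (s, v) = rot v n"
    unfolding unit_normal_def n by (simp add: p1[OF U(2)] p2 rot_cross rot_sgn)
  show ?thesis
    unfolding principal_curvature_def Let_def p11 p12 p22 un p2 p1[OF U(2)] rot_inner ..
qed

text \<open>Turns the eigenvalue problem of the shape operator into its characteristic equation.\<close>

lemma pencil_kernel_iff_det:
  fixes A B D :: real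
  shows "(\<exists>\<xi> \<eta>. (\<xi>, \<eta>) \<noteq> (0, 0) \<and> A * \<xi> + B * \<eta> = 0 \<and> B * \<xi> + D * \<eta> = 0) \<longleftrightarrow> A * D - B\<^sup>2 = 0"
    (is "?L \<longleftrightarrow> ?R")
proof
  assume ?L
  then obtain \<xi> \<eta> where e: "(\<xi>, \<eta>) \<noteq> (0, 0)" "A * \<xi> + B * \<eta> = 0" "B * \<xi> + D * \<eta> = 0" by blast
  have "(A * D - B\<^sup>2) * \<xi> = D * (A * \<xi> + B * \<eta>) - B * (B * \<xi> + D * \<eta>)"
    "(A * D - B\<^sup>2) * \<eta> = A * (B * \<xi> + D * \<eta>) - B * (A * \<xi> + B * \<eta>)"
    by algebra+
  with e show ?R by auto
next
  assume r: ?R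
  show ?L
  proof (cases "A = 0 \<and> B = 0")
    case True
    then show ?thesis by (intro exI[of _ 1] exI[of _ 0]) auto
  next
    case False
    with r show ?thesis
      by (intro exI[of _ "- B"] exI[of _ A]) (auto simp: algebra_simps power2_eq_square)
  qed
qed

section \<open>Derivatives of the profile curve\<close>

definition h_deriv :: "real \<Rightarrow> real \<Rightarrow> real \<Rightarrow> real" where
  "h_deriv k C s = 2 * C * s powr k * ((k - 1) * s\<^sup>2 + 1 + k) / (s\<^sup>2 + 1)\<^sup>2"

text \<open>The quotient \<open>g' / h'\<close>, see \<open>g_fun_has_derivative\<close>.\<close>

definition slope :: "real \<Rightarrow> real \<Rightarrow> real \<Rightarrow> real" where
  "slope k C s = ((k + 1) * s\<^sup>2 - k + 1) / (8 * k * s * sqrt (h_fun k C s))"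

text \<open>The quotient \<open>X' / h'\<close>. It never vanishes on the domain, which is why the
  zeros of \<open>h'\<close> account for all singular points of the profile.\<close>

definition profile_direction :: "real \<Rightarrow> real \<Rightarrow> real \<Rightarrow> real ^ 3" where
  "profile_direction k C s =
     vector [1 / (4 * t_fun k C s), slope k C s, slope k C s / t_fun k C s]"

lemma sum_square_one_pos: "s\<^sup>2 + 1 > 0" for s :: real
  by (simp add: add_nonneg_pos)

lemma h_fun_pos: "C > 0 \<Longrightarrow> s > 0 \<Longrightarrow> h_fun k C s > 0"
  unfolding h_fun_def by (intro divide_pos_pos mult_pos_pos sum_square_one_pos) auto

text \<open>The logarithmic derivative of \<open>h\<close> is rational in \<open>s\<close>; the
  power of \<open>s\<close> with exponent \<open>k\<close> disappears from every identity
  written relative to \<open>h\<close>.\<close>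

lemma h_deriv_eq:
  assumes "s > 0"
  shows "h_deriv k C s = h_fun k C s * (((k - 1) * s\<^sup>2 + 1 + k) / (s * (s\<^sup>2 + 1)))"
proof -
  have "s powr (k + 1) = s powr k * s" using assms by (simp add: powr_add)
  then show ?thesis
    using assms sum_square_one_pos[of s] unfolding h_deriv_def h_fun_def
    by (simp add: power2_eq_square[of "s\<^sup>2 + 1"])
qed

lemma h_fun_has_derivative:
  assumes "s > 0"
  shows "(h_fun k C has_real_derivative h_deriv k C s) (at s)"
proof -
  have n: "s\<^sup>2 + 1 \<noteq> 0" using sum_square_one_pos[of s] by simp
  have "((\<lambda>s. 2 * C * s powr (k + 1) / (s\<^sup>2 + 1)) has_real_derivative
      (2 * C * ((k + 1) * s powr k) * (s\<^sup>2 + 1) - 2 * C * s powr (k + 1) * (2 * s))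
        / ((s\<^sup>2 + 1) * (s\<^sup>2 + 1))) (at s)"
    using assms n by (auto intro!: derivative_eq_intros)
  moreover have "s powr (k + 1) = s powr k * s" using assms by (simp add: powr_add)
  ultimately show ?thesis
    unfolding h_fun_def[abs_def] h_deriv_def
    by (simp add: power2_eq_square algebra_simps)
qed

lemma sqrt_h_fun_has_derivative:
  assumes "C > 0" "s > 0"
  shows "((\<lambda>s. sqrt (h_fun k C s)) has_real_derivative h_deriv k C s / (2 * sqrt (h_fun k C s))) (at s)"
  using h_fun_has_derivative[OF assms(2)] h_fun_pos[OF assms, of k]
  by (auto intro!: derivative_eq_intros simp: field_simps)

lemma g_fun_has_derivative:
  assumes "C > 0" "k > 0" "s > 0"
  shows "(g_fun k C has_real_derivative h_deriv k C s * slope k C s) (at s)"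
proof -
  define r where "r = sqrt (h_fun k C s)"
  have r: "r > 0" "h_fun k C s = r\<^sup>2" using h_fun_pos[of C s k] assms by (simp_all add: r_def)
  have n: "s\<^sup>2 + 1 \<noteq> 0" using sum_square_one_pos[of s] by simp
  have "((\<lambda>s. ((k - 1) * s\<^sup>2 - (k + 1)) / (4 * k * s)) has_real_derivative
      ((k - 1) * s\<^sup>2 + 1 + k) / (4 * k * s\<^sup>2)) (at s)"
    using assms
    by (auto intro!: derivative_eq_intros) (simp add: divide_simps power2_eq_square algebra_simps)
  from DERIV_mult[OF this sqrt_h_fun_has_derivative[OF assms(1,3), of k]]
  have "(g_fun k C has_real_derivative
     ((k - 1) * s\<^sup>2 + 1 + k) / (4 * k * s\<^sup>2) * r
       + h_deriv k C s / (2 * r) * (((k - 1) * s\<^sup>2 - (k + 1)) / (4 * k * s))) (at s)"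
    unfolding g_fun_def[abs_def] r_def .
  moreover have "((k - 1) * s\<^sup>2 + 1 + k) / (4 * k * s\<^sup>2) * r
      = h_deriv k C s * ((s\<^sup>2 + 1) / (4 * k * s * r))"
    unfolding h_deriv_eq[OF assms(3)] r(2) using assms r n
    by (simp add: divide_simps power2_eq_square)
  moreover have "h_deriv k C s * ((s\<^sup>2 + 1) / (4 * k * s * r))
      + h_deriv k C s / (2 * r) * (((k - 1) * s\<^sup>2 - (k + 1)) / (4 * k * s))
      = h_deriv k C s * slope k C s"
  proof -
    have "slope k C s = (s\<^sup>2 + 1) / (4 * k * s * r)
        + 1 / (2 * r) * (((k - 1) * s\<^sup>2 - (k + 1)) / (4 * k * s))"
      unfolding slope_def r_def[symmetric] using assms r
      by (simp add: divide_simps) (simp add: algebra_simps)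
    then show ?thesis by (simp add: distrib_left)
  qed
  ultimately show ?thesis by simp
qed

lemma I_domD: "s \<in> I_dom k C \<Longrightarrow> s > 0 \<and> h_fun k C s > 1 \<and> t_fun k C s > 0"
  by (simp add: I_dom_def t_fun_def)

lemma h_fun_eq_t_fun: "s \<in> I_dom k C \<Longrightarrow> h_fun k C s = (t_fun k C s)\<^sup>2 + 1"
  by (simp add: I_dom_def t_fun_def)

lemma t_fun_has_derivative:
  assumes "s \<in> I_dom k C"
  shows "(t_fun k C has_real_derivative h_deriv k C s / (2 * t_fun k C s)) (at s)"
  using I_domD[OF assms] h_fun_has_derivative[of s k C]
  unfolding t_fun_def[abs_def] by (auto intro!: derivative_eq_intros simp: field_simps)

lemma h_fun_continuous_on: "continuous_on {0<..} (h_fun k C)"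
  by (rule continuous_at_imp_continuous_on) (auto intro: DERIV_isCont h_fun_has_derivative)

lemma open_I_dom: "open (I_dom k C)"
proof -
  have "I_dom k C = {0<..} \<inter> h_fun k C -` {1<..}"
    by (auto simp: I_dom_def)
  then show ?thesis
    using continuous_open_preimage[OF h_fun_continuous_on open_greaterThan open_greaterThan] by simp
qed

lemma profile_has_vector_derivative:
  assumes "C > 0" "k > 0" "s \<in> I_dom k C"
    and z: "(z has_real_derivative deriv (g_fun k C) s / t_fun k C s) (at s)"
  shows "(profile k C z has_vector_derivative h_deriv k C s *\<^sub>R profile_direction k C s) (at s)"
proof -
  note s = I_domD[OF assms(3)]
  have g: "(g_fun k C has_real_derivative h_deriv k C s * slope k C s) (at s)"
    using g_fun_has_derivative assms(1,2) s by blast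
  have "(profile k C z has_vector_derivative
      vector [h_deriv k C s / (2 * t_fun k C s) / 2, h_deriv k C s * slope k C s,
        deriv (g_fun k C) s / t_fun k C s]) (at s)"
    unfolding profile_def[abs_def]
    by (intro has_vector_derivative_vector_3 z g DERIV_cdivide t_fun_has_derivative assms(3))
  then show ?thesis
    unfolding DERIV_imp_deriv[OF g] profile_direction_def
    by (simp add: vector_3_eq_axis scaleR_add_right)
qed

lemma slope_differentiable:
  assumes "C > 0" "k > 0" "s > 0"
  obtains P' where "(slope k C has_real_derivative P') (at s)"
proof -
  have n: "8 * k * s * sqrt (h_fun k C s) \<noteq> 0" using assms h_fun_pos[of C s k] by simp
  have d: "((\<lambda>s. 8 * k * s) has_real_derivative 8 * k) (at s)"
    "((\<lambda>s. (k + 1) * s\<^sup>2 - k + 1) has_real_derivative (k + 1) * (2 * s)) (at s)"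
    by (auto intro!: derivative_eq_intros)
  show thesis
    using DERIV_divide[OF d(2) DERIV_mult[OF d(1) sqrt_h_fun_has_derivative[OF assms(1,3)]] n]
    by (rule that[unfolded slope_def[abs_def]])
qed

lemma h_deriv_differentiable:
  assumes "s > 0"
  obtains H' where "(h_deriv k C has_real_derivative H') (at s)"
proof -
  have "(s\<^sup>2 + 1)\<^sup>2 \<noteq> 0" using sum_square_one_pos[of s] by simp
  then have "\<exists>H'. (h_deriv k C has_real_derivative H') (at s)"
    unfolding h_deriv_def[abs_def] using assms
    by (auto intro!: exI derivative_eq_intros)
  then show thesis using that by blast
qed

text \<open>Only the relation between the derivatives of the last two coordinates matters: in the
  second fundamental form the unit normal is orthogonal to the first axis and proportional to
  \<open>(0, -1, t)\<close>, so the derivative \<open>P'\<close> of the slope cancels.\<close>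

lemma profile_direction_has_vector_derivative:
  assumes "C > 0" "k > 0" "s \<in> I_dom k C"
  obtains w' P' where "(profile_direction k C has_vector_derivative
    vector [w', P', P' / t_fun k C s - slope k C s * h_deriv k C s / (2 * t_fun k C s ^ 3)]) (at s)"
proof -
  note s = I_domD[OF assms(3)]
  from s obtain P' where P': "(slope k C has_real_derivative P') (at s)"
    using slope_differentiable assms(1,2) by blast
  note t' = t_fun_has_derivative[OF assms(3)]
  obtain w' where w': "((\<lambda>s. 1 / (4 * t_fun k C s)) has_real_derivative w') (at s)"
    using s t' by (atomize_elim) (auto intro!: exI derivative_eq_intros)
  have "((\<lambda>s. slope k C s / t_fun k C s) has_real_derivative
      P' / t_fun k C s - slope k C s * h_deriv k C s / (2 * t_fun k C s ^ 3)) (at s)"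
    using s by (intro DERIV_cong[OF DERIV_divide[OF P' t']])
      (auto simp: divide_simps power3_eq_cube algebra_simps)
  from has_vector_derivative_vector_3[OF w' P' this] show thesis
    by (intro that) (simp add: profile_direction_def[abs_def])
qed

text \<open>This quantity has two uses: it is the determinant that governs regularity and Gaussian
  curvature, and up to the factor \<open>2 h'\<close> it is the derivative of the squared distance to
  the axis. In both the point is that it has a fixed sign.\<close>

lemma slope_g_fun:
  assumes "C > 0" "k > 0" "s > 0"
  shows "slope k C s * g_fun k C s + 1 / 8 = (k\<^sup>2 - 1) * (s\<^sup>2 + 1)\<^sup>2 / (32 * k\<^sup>2 * s\<^sup>2)"
proof -
  have "sqrt (h_fun k C s) > 0" using assms h_fun_pos[of C s k] by simp
  then have "slope k C s * g_fun k C s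
      = ((k + 1) * s\<^sup>2 - k + 1) * ((k - 1) * s\<^sup>2 - (k + 1)) / (32 * k\<^sup>2 * s\<^sup>2)"
    using assms unfolding slope_def g_fun_def by (simp add: power2_eq_square)
  also have "\<dots> + 1 / 8 = (k\<^sup>2 - 1) * (s\<^sup>2 + 1)\<^sup>2 / (32 * k\<^sup>2 * s\<^sup>2)"
    using assms by (simp add: field_simps) algebra
  finally show ?thesis .
qed

text \<open>Up to normalization the numerator of the mean curvature; together with \<open>slope_g_fun\<close> it makes the
  ratio of squared mean curvature to Gaussian curvature independent of \<open>s\<close>.\<close>

lemma slope_h_fun_diff_g_fun:
  assumes "C > 0" "k > 0" "s > 0"
  shows "slope k C s * h_fun k C s - g_fun k C s / 2 = sqrt (h_fun k C s) * (s\<^sup>2 + 1) / (4 * k * s)"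
proof -
  define r where "r = sqrt (h_fun k C s)"
  have r: "r > 0" "h_fun k C s = r\<^sup>2" using h_fun_pos[of C s k] assms by (simp_all add: r_def)
  show ?thesis unfolding slope_def g_fun_def r_def[symmetric] r(2) using assms r
    by (simp add: divide_simps power2_eq_square) (simp add: algebra_simps)
qed

section \<open>Principal curvatures\<close>

text \<open>The first coordinate of the cross product vanishes because the third coordinate of the
  profile is the integral of \<open>g' / t\<close>; this is what makes the normal so simple.\<close>

lemma profile_cross:
  assumes "C > 0" "k > 0" "s \<in> I_dom k C"
  shows "cross3 (c *\<^sub>R profile_direction k C s) (helical_velocity (profile k C z s))
    = (c * (slope k C s * g_fun k C s + 1 / 8) / t_fun k C s) *\<^sub>R vector [0, -1, t_fun k C s]"
proof -
  have "t_fun k C s > 0" using I_domD[OF assms(3)] by simp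
  then show ?thesis
    by (simp add: cross3_def vec_eq_iff forall_3 profile_direction_def helical_velocity_def
        profile_def field_simps)
qed

lemma norm_normal_vector:
  assumes "s \<in> I_dom k C"
  shows "norm (vector [0, -1, t_fun k C s] :: real ^ 3) = sqrt (h_fun k C s)"
  unfolding norm_eq_sqrt_inner inner_3 h_fun_eq_t_fun[OF assms]
  by (simp add: power2_eq_square)

lemma slope_g_fun_nonzero:
  assumes "C > 0" "k > 0" "k \<noteq> 1" "s > 0"
  shows "slope k C s * g_fun k C s + 1 / 8 \<noteq> 0"
proof -
  have "k\<^sup>2 \<noteq> 1" using assms by (simp add: power2_eq_1_iff)
  then show ?thesis
    using assms sum_square_one_pos[of s] by (simp add: slope_g_fun)
qed

text \<open>The pencil is the pair of fundamental forms with \<open>H = h'\<close>, \<open>r\<close> the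
  square root of \<open>h\<close>, \<open>P\<close> the slope and \<open>\<sigma>\<close> the orientation
  sign of the normal. Rescaling the first variable by \<open>H / t\<close> removes both, and the
  characteristic equation becomes the quadratic
  \<open>r\<^sup>2 Q x\<^sup>2 - \<sigma> T x - \<sigma>\<^sup>2 / 2 = 0\<close> in
  \<open>x = \<kappa> r\<close>. Its discriminant is \<open>\<sigma>\<^sup>2 (T\<^sup>2 + 2 r\<^sup>2 Q)\<close>, which
  the last hypothesis identifies with \<open>(\<sigma> k T)\<^sup>2\<close>.\<close>

lemma helical_pencil_eigenvalues:
  fixes H t r P g q k \<kappa> \<sigma> Q T :: real
  assumes pos: "t > 0" "r > 0" "H \<noteq> 0"
    and Q: "Q = P * g + 1 / 8" "Q \<noteq> 0" and T: "T = P * r\<^sup>2 - g / 2"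
    and k: "(1 - k\<^sup>2) * T\<^sup>2 = - 2 * r\<^sup>2 * Q"
  shows "(\<exists>\<xi> \<eta>. (\<xi>, \<eta>) \<noteq> (0, 0) \<and>
      - \<sigma> * H\<^sup>2 * P / (2 * t\<^sup>2 * r) * \<xi> + - \<sigma> * H / (4 * t * r) * \<eta>
        = \<kappa> * (H\<^sup>2 * (1 / 16 + P\<^sup>2 * r\<^sup>2) / t\<^sup>2 * \<xi> + H * (P * r\<^sup>2 / 2 - g / 4) / t * \<eta>) \<and>
      - \<sigma> * H / (4 * t * r) * \<xi> + \<sigma> * g / r * \<eta>
        = \<kappa> * (H * (P * r\<^sup>2 / 2 - g / 4) / t * \<xi> + (g\<^sup>2 + r\<^sup>2 / 4) * \<eta>))
    \<longleftrightarrow> \<kappa> = \<sigma> * T * (1 + k) / (2 * r ^ 3 * Q) \<or> \<kappa> = \<sigma> * T * (1 - k) / (2 * r ^ 3 * Q)"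
    (is "?L \<longleftrightarrow> ?R")
proof -
  let ?x = "\<kappa> * r"
  define A where "A = - \<sigma> * P / 2 - ?x * (1 / 16 + P\<^sup>2 * r\<^sup>2)"
  define B where "B = - \<sigma> / 4 - ?x * (P * r\<^sup>2 / 2 - g / 4)"
  define D where "D = \<sigma> * g - ?x * (g\<^sup>2 + r\<^sup>2 / 4)"
  have "?L \<longleftrightarrow> (\<exists>\<xi> \<eta>. (\<xi>, \<eta>) \<noteq> (0, 0) \<and>
      (H\<^sup>2 / (t\<^sup>2 * r) * A) * \<xi> + (H / (t * r) * B) * \<eta> = 0 \<and>
      (H / (t * r) * B) * \<xi> + (D / r) * \<eta> = 0)"
  proof -
    have "- \<sigma> * H\<^sup>2 * P / (2 * t\<^sup>2 * r) * \<xi> + - \<sigma> * H / (4 * t * r) * \<eta>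
        - \<kappa> * (H\<^sup>2 * (1 / 16 + P\<^sup>2 * r\<^sup>2) / t\<^sup>2 * \<xi> + H * (P * r\<^sup>2 / 2 - g / 4) / t * \<eta>)
        = (H\<^sup>2 / (t\<^sup>2 * r) * A) * \<xi> + (H / (t * r) * B) * \<eta>" for \<xi> \<eta>
      unfolding A_def B_def using pos by (simp add: divide_simps) (simp add: algebra_simps)
    moreover have "- \<sigma> * H / (4 * t * r) * \<xi> + \<sigma> * g / r * \<eta>
        - \<kappa> * (H * (P * r\<^sup>2 / 2 - g / 4) / t * \<xi> + (g\<^sup>2 + r\<^sup>2 / 4) * \<eta>)
        = (H / (t * r) * B) * \<xi> + (D / r) * \<eta>" for \<xi> \<eta>
      unfolding B_def D_def using pos by (simp add: divide_simps) (simp add: algebra_simps)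
    ultimately show ?thesis by (metis (no_types, lifting) eq_iff_diff_eq_0)
  qed
  also have "\<dots> \<longleftrightarrow> (H\<^sup>2 / (t\<^sup>2 * r) * A) * (D / r) - (H / (t * r) * B)\<^sup>2 = 0"
    by (rule pencil_kernel_iff_det)
  also have "(H\<^sup>2 / (t\<^sup>2 * r) * A) * (D / r) - (H / (t * r) * B)\<^sup>2 = (H / (t * r))\<^sup>2 * (A * D - B\<^sup>2)"
    by (simp add: power2_eq_square diff_divide_distrib algebra_simps)
  also have "\<dots> = 0 \<longleftrightarrow> A * D - B\<^sup>2 = 0" using pos by simp
  also have "A * D - B\<^sup>2 = Q * (r\<^sup>2 * Q * ?x\<^sup>2 - \<sigma> * T * ?x - \<sigma>\<^sup>2 / 2)"
    unfolding A_def B_def D_def Q(1) T by (simp add: field_simps) algebra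
  also have "\<dots> = 0 \<longleftrightarrow> r\<^sup>2 * Q * ?x\<^sup>2 - \<sigma> * T * ?x - \<sigma>\<^sup>2 / 2 = 0"
    using Q(2) by simp
  also have "\<dots> \<longleftrightarrow> 4 * r\<^sup>2 * Q * (r\<^sup>2 * Q * ?x\<^sup>2 - \<sigma> * T * ?x - \<sigma>\<^sup>2 / 2) = 0"
    using pos Q(2) by simp
  \<comment> \<open>The factor \<open>4 r\<^sup>2 Q\<close> completes the square; the discriminant is then \<open>(\<sigma> k T)\<^sup>2\<close>.\<close>
  also have "4 * r\<^sup>2 * Q * (r\<^sup>2 * Q * ?x\<^sup>2 - \<sigma> * T * ?x - \<sigma>\<^sup>2 / 2)
      = (2 * r ^ 3 * Q * \<kappa> - \<sigma> * T * (1 + k)) * (2 * r ^ 3 * Q * \<kappa> - \<sigma> * T * (1 - k))"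
    using k by algebra
  also have "\<dots> = 0 \<longleftrightarrow> 2 * r ^ 3 * Q * \<kappa> = \<sigma> * T * (1 + k) \<or> 2 * r ^ 3 * Q * \<kappa> = \<sigma> * T * (1 - k)"
    by simp
  also have "\<dots> \<longleftrightarrow> ?R"
  proof -
    have "2 * r ^ 3 * Q * \<kappa> = c \<longleftrightarrow> \<kappa> = c / (2 * r ^ 3 * Q)" for c
      using pos Q(2) by (simp add: eq_divide_eq mult.commute)
    then show ?thesis by simp
  qed
  finally show ?thesis .
qed

lemma helical_principal_curvatures:
  assumes "C > 0" "k > 0" "k \<noteq> 1" "s \<in> I_dom k C" "(k - 1) * s\<^sup>2 + 1 + k \<noteq> 0"
    and z: "\<forall>s\<in>I_dom k C. (z has_real_derivative deriv (g_fun k C) s / t_fun k C s) (at s)"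
  obtains c where "c \<noteq> 0"
    "{\<kappa>. principal_curvature (helical_surface (profile k C z)) (s, v) \<kappa>} = {c * (1 + k), c * (1 - k)}"
proof -
  note s = I_domD[OF assms(4)]
  define H where "H = h_deriv k C s"
  define t where "t = t_fun k C s"
  define r where "r = sqrt (h_fun k C s)"
  define P where "P = slope k C s"
  define g where "g = g_fun k C s"
  define Q where "Q = P * g + 1 / 8"
  define \<sigma> where "\<sigma> = sgn (H * Q)"
  define T where "T = P * r\<^sup>2 - g / 2"
  have pos: "t > 0" "r > 0" "r\<^sup>2 = t\<^sup>2 + 1"
    using s h_fun_eq_t_fun[OF assms(4)] sum_square_one_pos[of "t_fun k C s"]
    by (simp_all add: t_def r_def)
  have h: "h_fun k C s = r\<^sup>2" using s by (simp add: r_def)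
  have H0: "H \<noteq> 0"
    unfolding H_def h_deriv_def using assms(1,5) s sum_square_one_pos[of s] by simp
  have Q0: "Q \<noteq> 0"
    unfolding Q_def P_def g_def using slope_g_fun_nonzero assms(1-3) s by blast
  have sg: "\<sigma>\<^sup>2 = 1" unfolding \<sigma>_def using H0 Q0 by (auto simp: sgn_if)
  have T_eq: "T = r * (s\<^sup>2 + 1) / (4 * k * s)"
    unfolding T_def P_def g_def h[symmetric] using slope_h_fun_diff_g_fun[OF assms(1,2)] s
    by (simp add: r_def)
  have T0: "T > 0"
    unfolding T_eq using pos s assms(2) sum_square_one_pos[of s] by simp
  have kT: "(1 - k\<^sup>2) * T\<^sup>2 = - 2 * r\<^sup>2 * Q"
  proof -
    have "Q = (k\<^sup>2 - 1) * (s\<^sup>2 + 1)\<^sup>2 / (32 * k\<^sup>2 * s\<^sup>2)"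
      unfolding Q_def P_def g_def using slope_g_fun assms(1,2) s by blast
    then show ?thesis unfolding T_eq using s assms(2)
      by (simp add: power_divide power_mult_distrib field_simps) algebra
  qed
  let ?X = "profile k C z" and ?w = "profile_direction k C"
  define n :: "real ^ 3" where "n = vector [0, - \<sigma> / r, \<sigma> * t / r]"
  have n: "n = sgn (cross3 (h_deriv k C s *\<^sub>R ?w s) (helical_velocity (?X s)))"
  proof -
    have "sgn (H * Q / t) = \<sigma>" using pos by (simp add: \<sigma>_def sgn_divide)
    moreover have "sgn (vector [0, -1, t] :: real ^ 3) = (1 / r) *\<^sub>R vector [0, -1, t]"
      using norm_normal_vector[OF assms(4)] by (simp add: sgn_div_norm t_def r_def divide_inverse)
    ultimately have "n = sgn ((H * Q / t) *\<^sub>R vector [0, -1, t])"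
      unfolding sgn_scaleR by (simp add: n_def vec_eq_iff forall_3)
    then show ?thesis
      unfolding profile_cross[OF assms(1,2,4)] by (simp add: H_def Q_def P_def g_def t_def)
  qed
  obtain H' where H': "(h_deriv k C has_real_derivative H') (at s)"
    using h_deriv_differentiable s by blast
  obtain w' P' where w': "(?w has_vector_derivative vector [w', P', P' / t - P * H / (2 * t ^ 3)]) (at s)"
    using profile_direction_has_vector_derivative[OF assms(1,2,4)] unfolding t_def P_def H_def by blast
  define \<gamma>2 where "\<gamma>2 = H *\<^sub>R vector [w', P', P' / t - P * H / (2 * t ^ 3)] + H' *\<^sub>R ?w s"
  have d2: "((\<lambda>s. h_deriv k C s *\<^sub>R ?w s) has_vector_derivative \<gamma>2) (at s)"
    unfolding \<gamma>2_def H_def by (rule has_vector_derivative_scaleR[OF H' w'[unfolded H_def]])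
  have d1: "\<forall>u\<in>I_dom k C. (?X has_vector_derivative h_deriv k C u *\<^sub>R ?w u) (at u)"
    using profile_has_vector_derivative[OF assms(1,2)] z by blast
  have X: "?X s $ 1 = t / 2" "?X s $ 2 = g" and w: "?w s $ 1 = 1 / (4 * t)" "?w s $ 2 = P" "?w s $ 3 = P / t"
    by (simp_all add: profile_def profile_direction_def t_def P_def g_def)
  have II: "\<gamma>2 \<bullet> n = - \<sigma> * H\<^sup>2 * P / (2 * t\<^sup>2 * r)"
    "quarter_turn (h_deriv k C s *\<^sub>R ?w s) \<bullet> n = - \<sigma> * H / (4 * t * r)"
    "quarter_turn (helical_velocity (?X s)) \<bullet> n = \<sigma> * g / r"
    unfolding inner_3 n_def \<gamma>2_def quarter_turn_def helical_velocity_def H_def[symmetric] using pos(1,2)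
    by (simp_all add: X w divide_simps power2_eq_square power3_eq_cube) (simp add: algebra_simps)
  have I: "(h_deriv k C s *\<^sub>R ?w s) \<bullet> (h_deriv k C s *\<^sub>R ?w s) = H\<^sup>2 * (1 / 16 + P\<^sup>2 * r\<^sup>2) / t\<^sup>2"
    "(h_deriv k C s *\<^sub>R ?w s) \<bullet> helical_velocity (?X s) = H * (P * r\<^sup>2 / 2 - g / 4) / t"
    "helical_velocity (?X s) \<bullet> helical_velocity (?X s) = g\<^sup>2 + r\<^sup>2 / 4"
    unfolding inner_3 helical_velocity_def H_def[symmetric] pos(3) using pos(1)
    by (simp_all add: X w divide_simps power2_eq_square) (simp_all add: algebra_simps)
  have "principal_curvature (helical_surface ?X) (s, v) \<kappa> \<longleftrightarrow>
      \<kappa> = \<sigma> * T * (1 + k) / (2 * r ^ 3 * Q) \<or> \<kappa> = \<sigma> * T * (1 - k) / (2 * r ^ 3 * Q)" for \<kappa>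
    unfolding helical_surface_principal_curvature[OF open_I_dom assms(4) d1 d2 n] II I
    by (rule helical_pencil_eigenvalues[OF pos(1,2) H0 Q_def Q0 T_def kT])
  moreover have "\<sigma> * T / (2 * r ^ 3 * Q) \<noteq> 0" using sg T0 pos(2) Q0 by auto
  ultimately show thesis
    by (intro that[of "\<sigma> * T / (2 * r ^ 3 * Q)"]) auto
qed

text \<open>The equation for \<open>k\<close> determines \<open>a\<close> up to inversion, which is
  the ambiguity in the order of the two principal curvatures.\<close>

lemma curvature_ratio_parameter:
  fixes a k :: real
  assumes a: "a \<notin> {0, 1, -1}" and k: "k = \<bar>(a - 1) / (a + 1)\<bar>"
  shows "k > 0" "k \<noteq> 1" "a = (1 + k) / (1 - k) \<or> a = (1 - k) / (1 + k)" "k < 1 \<longleftrightarrow> a > 0"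
proof -
  have n: "a + 1 \<noteq> 0" "a - 1 \<noteq> 0" "a \<noteq> 0" using a by auto
  then show "k > 0" unfolding k by simp
  have k2: "k\<^sup>2 = (a - 1)\<^sup>2 / (a + 1)\<^sup>2" unfolding k by (simp add: power_divide)
  have e: "1 - k\<^sup>2 = 4 * a / (a + 1)\<^sup>2"
    unfolding k2 using n by (simp add: divide_simps) (simp add: algebra_simps power2_eq_square)
  then show "k \<noteq> 1" using n by auto
  have "k < 1 \<longleftrightarrow> 1 - k\<^sup>2 > 0"
    using \<open>k > 0\<close> by (simp add: power_less_one_iff abs_square_less_1)
  also have "\<dots> \<longleftrightarrow> a > 0" unfolding e using n by (simp add: zero_less_divide_iff)
  finally show "k < 1 \<longleftrightarrow> a > 0" .
  have "k * (a + 1) = a - 1 \<or> k * (a + 1) = - (a - 1)"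
    unfolding k using n by (auto simp: abs_if)
  then show "a = (1 + k) / (1 - k) \<or> a = (1 - k) / (1 + k)"
    using \<open>k > 0\<close> \<open>k \<noteq> 1\<close> by (auto simp: field_simps)
qed

lemma helical_curvature_ratio:
  assumes a: "a \<notin> {0, 1, -1}" and k: "k = \<bar>(a - 1) / (a + 1)\<bar>" and "C > 0"
    and s: "s \<in> I_dom k C" "(k - 1) * s\<^sup>2 + 1 + k \<noteq> 0"
    and z: "\<forall>s\<in>I_dom k C. (z has_real_derivative deriv (g_fun k C) s / t_fun k C s) (at s)"
  shows "principal_curvature_ratio (helical_surface (profile k C z)) (s, v) a"
proof -
  note kk = curvature_ratio_parameter[OF a k]
  obtain c where c: "c \<noteq> 0" "{\<kappa>. principal_curvature (helical_surface (profile k C z)) (s, v) \<kappa>}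
      = {c * (1 + k), c * (1 - k)}"
    using helical_principal_curvatures[OF \<open>C > 0\<close> kk(1,2) s z] by blast
  from kk(3) show ?thesis
  proof
    assume "a = (1 + k) / (1 - k)"
    then show ?thesis unfolding principal_curvature_ratio_def c(2) using c(1) kk(1,2)
      by (intro exI[of _ "c * (1 + k)"] exI[of _ "c * (1 - k)"]) auto
  next
    assume "a = (1 - k) / (1 + k)"
    then show ?thesis unfolding principal_curvature_ratio_def c(2) using c(1) kk(1,2)
      by (intro exI[of _ "c * (1 - k)"] exI[of _ "c * (1 + k)"]) auto
  qed
qed

lemma helical_regular_point:
  assumes "C > 0" "k > 0" "k \<noteq> 1" "s \<in> I_dom k C" "(k - 1) * s\<^sup>2 + 1 + k \<noteq> 0"
    and z: "\<forall>s\<in>I_dom k C. (z has_real_derivative deriv (g_fun k C) s / t_fun k C s) (at s)"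
  shows "regular_point (helical_surface (profile k C z)) (s, v)"
proof (rule helical_surface_regular_point)
  note s = I_domD[OF assms(4)]
  show "(profile k C z has_vector_derivative h_deriv k C s *\<^sub>R profile_direction k C s) (at s)"
    using profile_has_vector_derivative assms by blast
  have "h_deriv k C s \<noteq> 0"
    unfolding h_deriv_def using assms(1,5) s sum_square_one_pos[of s] by simp
  moreover have "vector [0, -1, t_fun k C s] \<noteq> (0 :: real ^ 3)"
    by (simp add: vec_eq_iff forall_3)
  ultimately show "cross3 (h_deriv k C s *\<^sub>R profile_direction k C s)
      (helical_velocity (profile k C z s)) \<noteq> 0"
    unfolding profile_cross[OF assms(1,2,4)]
    using s slope_g_fun_nonzero[OF assms(1-3), of s] by simp
qed

section \<open>Shape of the domain and distance to the axis\<close>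

text \<open>The point \<open>sk\<close> is the positive zero of the common factor; the factored form shows
  how \<open>h'\<close> changes sign there.\<close>

lemma turning_point:
  assumes "0 < k" "k < 1" "sk = sqrt ((1 + k) / (1 - k))"
  shows "sk > 0" "(k - 1) * s\<^sup>2 + 1 + k = (1 - k) * (sk\<^sup>2 - s\<^sup>2)"
  using assms by (simp_all add: field_simps)

lemma h_deriv_sign:
  assumes "C > 0" "0 < k" "k < 1" "sk = sqrt ((1 + k) / (1 - k))" "s > 0"
  shows "s < sk \<Longrightarrow> h_deriv k C s > 0" "s > sk \<Longrightarrow> h_deriv k C s < 0" "s = sk \<Longrightarrow> h_deriv k C s = 0"
proof -
  note sk = turning_point[OF assms(2-4)]
  define c where "c = 2 * C * s powr k * (1 - k) / (s\<^sup>2 + 1)\<^sup>2"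
  have c: "c > 0"
    unfolding c_def using assms sum_square_one_pos[of s] by simp
  have e: "h_deriv k C s = c * (sk\<^sup>2 - s\<^sup>2)"
    unfolding h_deriv_def sk(2) c_def by simp
  show "s < sk \<Longrightarrow> h_deriv k C s > 0" "s > sk \<Longrightarrow> h_deriv k C s < 0"
    unfolding e using c assms(5) sk(1)
    by (auto simp: zero_less_mult_iff mult_less_0_iff intro!: power_strict_mono)
  show "s = sk \<Longrightarrow> h_deriv k C s = 0" unfolding e by simp
qed

lemma h_fun_unimodal:
  assumes "C > 0" "0 < k" "k < 1" "sk = sqrt ((1 + k) / (1 - k))" "0 < a" "a < b"
  shows "b \<le> sk \<Longrightarrow> h_fun k C a < h_fun k C b" "sk \<le> a \<Longrightarrow> h_fun k C b < h_fun k C a"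
proof -
  note sg = h_deriv_sign[OF assms(1-4)]
  have co: "continuous_on {a..b} (h_fun k C)"
    by (rule continuous_on_subset[OF h_fun_continuous_on]) (use assms in auto)
  show "h_fun k C a < h_fun k C b" if "b \<le> sk"
  proof (rule DERIV_pos_imp_increasing_open[OF assms(6) _ co])
    fix x assume "a < x" "x < b"
    then show "\<exists>y. DERIV (h_fun k C) x :> y \<and> y > 0"
      using sg(1)[of x] h_fun_has_derivative[of x k C] assms(5) that by force
  qed
  show "h_fun k C b < h_fun k C a" if "sk \<le> a"
  proof (rule DERIV_neg_imp_decreasing_open[OF assms(6) _ co])
    fix x assume "a < x" "x < b"
    then show "\<exists>y. DERIV (h_fun k C) x :> y \<and> y < 0"
      using sg(2)[of x] h_fun_has_derivative[of x k C] assms(5) that by force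
  qed
qed

lemma h_fun_le_max:
  assumes "C > 0" "0 < k" "k < 1" "sk = sqrt ((1 + k) / (1 - k))" "s > 0"
  shows "h_fun k C s \<le> h_fun k C sk"
  using h_fun_unimodal(1)[OF assms, of sk] h_fun_unimodal(2)[OF assms(1-4), of sk s]
    turning_point(1)[OF assms(2-4)] by (cases s sk rule: linorder_cases) auto

lemma h_fun_small_near_0:
  assumes "C > 0" "0 < k" "e > 0"
  obtains s where "0 < s" "s < e" "h_fun k C s < 1"
proof -
  define s where "s = min (e / 2) (min 1 (1 / (2 * C)))"
  have s: "0 < s" "s < e" "s \<le> 1" using assms by (auto simp: s_def)
  have "s \<le> 1 / (2 * C)" unfolding s_def by linarith
  then have sC: "2 * C * s \<le> 1" using assms by (simp add: field_simps)
  have "s powr (k + 1) \<le> s powr 1" by (rule powr_mono') (use s assms in auto)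
  then have "2 * C * s powr (k + 1) \<le> 2 * C * s" using s assms by simp
  also have "\<dots> < s\<^sup>2 + 1" using s sC by (smt (verit) zero_less_power)
  finally have "h_fun k C s < 1"
    unfolding h_fun_def using sum_square_one_pos[of s] by simp
  with s show thesis using that by blast
qed

text \<open>For \<open>k < 1\<close> the numerator grows more slowly than \<open>s\<^sup>2\<close>.\<close>

lemma h_fun_small_near_infinity:
  assumes "C > 0" "k < 1" "0 < e"
  obtains s where "s > e" "h_fun k C s < 1"
proof -
  have "((\<lambda>s. 2 * C * s powr (k - 1)) \<longlongrightarrow> 2 * C * 0) at_top"
    using assms by (intro tendsto_mult tendsto_const tendsto_neg_powr filterlim_ident) auto
  then have "\<forall>\<^sub>F s in at_top. 2 * C * s powr (k - 1) < 1"
    by (intro order_tendstoD(2)) auto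
  then have "\<forall>\<^sub>F s in at_top. s > e \<and> 2 * C * s powr (k - 1) < 1"
    using eventually_gt_at_top eventually_conj by blast
  then obtain s where s: "s > e" "2 * C * s powr (k - 1) < 1"
    unfolding eventually_at_top_linorder by blast
  have "s powr (k + 1) = s powr (k - 1) * s\<^sup>2"
    using s assms(3) by (simp add: add.commute flip: powr_add powr_numeral)
  then have "2 * C * s powr (k + 1) = (2 * C * s powr (k - 1)) * s\<^sup>2" by simp
  also have "\<dots> \<le> 1 * s\<^sup>2" using s by (intro mult_right_mono) auto
  also have "\<dots> < s\<^sup>2 + 1" by simp
  finally have "h_fun k C s < 1"
    unfolding h_fun_def using sum_square_one_pos[of s] by simp
  with s that show thesis by blast
qed

lemma I_dom_interval:
  assumes "C > 0" "0 < k" "k < 1" "sk = sqrt ((1 + k) / (1 - k))" "I_dom k C \<noteq> {}"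
  obtains s1 s2 where "0 < s1" "s1 < sk" "sk < s2" "h_fun k C s2 = 1" "I_dom k C = {s1<..<s2}"
proof -
  have sk: "sk > 0" using turning_point[OF assms(2-4)] by blast
  note mono = h_fun_unimodal[OF assms(1-4)]
  have top: "h_fun k C sk > 1"
    using assms(5) h_fun_le_max[OF assms(1-4)] by (fastforce simp: I_dom_def)
  obtain a where a: "0 < a" "a < sk" "h_fun k C a < 1"
    using h_fun_small_near_0[OF assms(1,2) sk] by blast
  obtain b where b: "sk < b" "h_fun k C b < 1"
    using h_fun_small_near_infinity[OF assms(1,3) sk] by blast
  have co: "continuous_on {x..y} (h_fun k C)" if "0 < x" for x y
    by (rule continuous_on_subset[OF h_fun_continuous_on]) (use that in auto)
  obtain s1 where s1: "a \<le> s1" "s1 \<le> sk" "h_fun k C s1 = 1"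
    using IVT'[of "h_fun k C" a 1 sk] a top co by fastforce
  obtain s2 where s2: "sk \<le> s2" "s2 \<le> b" "h_fun k C s2 = 1"
    using IVT2'[of "h_fun k C" b 1 sk] b top co sk by fastforce
  have lt: "0 < s1" "s1 < sk" "sk < s2"
    using s1 s2 a top by (auto simp: less_le)
  have "h_fun k C s > 1 \<longleftrightarrow> s1 < s \<and> s < s2" if "s > 0" for s
  proof (cases "s \<le> sk")
    case True
    then show ?thesis
      using mono(1)[of s1 s] mono(1)[of s s1] s1 lt that
      by (cases s s1 rule: linorder_cases) auto
  next
    case False
    then show ?thesis
      using mono(2)[of s2 s] mono(2)[of s s2] s2 lt that
      by (cases s s2 rule: linorder_cases) auto
  qed
  then have "I_dom k C = {s1<..<s2}" using lt by (auto simp: I_dom_def)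
  with lt s2(3) show thesis using that by blast
qed

text \<open>The expression is the squared distance of the profile point from the axis. Its derivative
  is \<open>2 h' (P g + 1/8)\<close> with the bracket negative for \<open>k < 1\<close>, so the
  distance decreases while \<open>h\<close> increases and is strictly minimal at \<open>sk\<close>.
  As helical motions preserve this distance, no other point of the surface lies on the helix
  through the cusp.\<close>

lemma profile_axis_distance_minimal:
  assumes "C > 0" "0 < k" "k < 1" "sk = sqrt ((1 + k) / (1 - k))" "0 < s" "s \<noteq> sk"
  shows "(h_fun k C sk - 1) / 4 + (g_fun k C sk)\<^sup>2 < (h_fun k C s - 1) / 4 + (g_fun k C s)\<^sup>2"
proof -
  let ?R = "\<lambda>s. (h_fun k C s - 1) / 4 + (g_fun k C s)\<^sup>2"
  have sk: "sk > 0" using turning_point[OF assms(2-4)] by blast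
  note sg = h_deriv_sign[OF assms(1-4)]
  have d: "(?R has_real_derivative 2 * h_deriv k C x * (slope k C x * g_fun k C x + 1 / 8)) (at x)"
    if "x > 0" for x
    using h_fun_has_derivative[OF that, of k C] g_fun_has_derivative[OF assms(1,2) that]
    by (auto intro!: derivative_eq_intros simp: algebra_simps)
  have Q: "slope k C x * g_fun k C x + 1 / 8 < 0" if "x > 0" for x
  proof -
    have "k\<^sup>2 - 1 < 0" using assms(2,3) by (simp add: abs_square_less_1)
    then show ?thesis
      unfolding slope_g_fun[OF assms(1,2) that] using that assms(2) sum_square_one_pos[of x]
      by (intro divide_neg_pos mult_neg_pos) auto
  qed
  have co: "continuous_on {x..y} ?R" if "0 < x" for x y
    by (rule DERIV_atLeastAtMost_imp_continuous_on) (rule exI, rule d, use that in simp)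
  show ?thesis
  proof (cases "s < sk")
    case True
    show ?thesis
    proof (rule DERIV_neg_imp_decreasing_open[OF True _ co[OF assms(5)]])
      fix x assume x: "s < x" "x < sk"
      then have "2 * h_deriv k C x * (slope k C x * g_fun k C x + 1 / 8) < 0"
        using sg(1)[of x] Q[of x] assms(5) by (intro mult_pos_neg) auto
      with d[of x] x assms(5) show "\<exists>y. DERIV ?R x :> y \<and> y < 0" by force
    qed
  next
    case False
    with assms(6) have gt: "sk < s" by simp
    show ?thesis
    proof (rule DERIV_pos_imp_increasing_open[OF gt _ co[OF sk]])
      fix x assume x: "sk < x" "x < s"
      then have "2 * h_deriv k C x * (slope k C x * g_fun k C x + 1 / 8) > 0"
        using sg(2)[of x] Q[of x] sk by (intro mult_neg_neg) auto
      with d[of x] x sk show "\<exists>y. DERIV ?R x :> y \<and> y > 0" by force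
    qed
  qed
qed

lemma helical_motion_axis_distance:
  "(helical_motion v p $ 1)\<^sup>2 + (helical_motion v p $ 2)\<^sup>2 = (p $ 1)\<^sup>2 + (p $ 2)\<^sup>2"
proof -
  have "(helical_motion v p $ 1)\<^sup>2 + (helical_motion v p $ 2)\<^sup>2
      = ((p $ 1)\<^sup>2 + (p $ 2)\<^sup>2) * ((cos v)\<^sup>2 + (sin v)\<^sup>2)"
    unfolding helical_motion_def vector_3 by algebra
  then show ?thesis by simp
qed

lemma profile_direction_nonzero: "s \<in> I_dom k C \<Longrightarrow> profile_direction k C s \<noteq> 0"
proof
  assume "s \<in> I_dom k C" and 0: "profile_direction k C s = 0"
  then have "t_fun k C s > 0" by (simp add: I_domD)
  moreover have "profile_direction k C s $ 1 = 0" unfolding 0 by simp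
  ultimately show False by (simp add: profile_direction_def)
qed

lemma isCont_profile_direction:
  assumes "C > 0" "k > 0" "s \<in> I_dom k C"
  shows "isCont (profile_direction k C) s"
  by (rule profile_direction_has_vector_derivative[OF assms]) (rule has_vector_derivative_continuous)

section \<open>The cusp and the singular curve\<close>

text \<open>A simple mechanism for cusps: the velocity is a nonvanishing continuous field multiplied by
  a scalar that changes sign.\<close>

lemma cusp_atI:
  fixes \<gamma> w :: "real \<Rightarrow> 'a :: real_normed_vector"
  assumes d: "\<forall>\<^sub>F r in nhds s. (\<gamma> has_vector_derivative c r *\<^sub>R w r) (at r)"
    and "c s = 0" "\<forall>\<^sub>F r in at_left s. c r > 0" "\<forall>\<^sub>F r in at_right s. c r < 0"
    and w: "isCont w s" "w s \<noteq> 0"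
  shows "cusp_at \<gamma> s"
proof -
  have at_d: "\<forall>\<^sub>F r in at s. (\<gamma> has_vector_derivative c r *\<^sub>R w r) (at r)"
    using d by (simp add: eventually_nhds_conv_at)
  have side: "\<forall>\<^sub>F r in at_left s. (\<gamma> has_vector_derivative c r *\<^sub>R w r) (at r)"
    "\<forall>\<^sub>F r in at_right s. (\<gamma> has_vector_derivative c r *\<^sub>R w r) (at r)"
    using at_d by (simp_all add: eventually_at_split)
  have lim: "((\<lambda>r. sgn (w r)) \<longlongrightarrow> sgn (w s)) (at s)"
    using w by (intro tendsto_sgn) (auto simp: isCont_def)
  have "((\<lambda>r. sgn (vector_derivative \<gamma> (at r))) \<longlongrightarrow> sgn (w s)) (at_left s)"
  proof (rule Lim_transform_eventually)
    show "((\<lambda>r. sgn (w r)) \<longlongrightarrow> sgn (w s)) (at_left s)"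
      using lim by (simp add: filterlim_at_split)
    show "\<forall>\<^sub>F r in at_left s. sgn (w r) = sgn (vector_derivative \<gamma> (at r))"
      using side(1) assms(3)
      by eventually_elim (simp add: vector_derivative_at sgn_scaleR)
  qed
  moreover have "((\<lambda>r. sgn (vector_derivative \<gamma> (at r))) \<longlongrightarrow> - sgn (w s)) (at_right s)"
  proof (rule Lim_transform_eventually)
    show "((\<lambda>r. - sgn (w r)) \<longlongrightarrow> - sgn (w s)) (at_right s)"
      using lim by (intro tendsto_minus) (simp add: filterlim_at_split)
    show "\<forall>\<^sub>F r in at_right s. - sgn (w r) = sgn (vector_derivative \<gamma> (at r))"
      using side(2) assms(4)
      by eventually_elim (simp add: vector_derivative_at sgn_scaleR)
  qed
  moreover have "(\<gamma> has_vector_derivative 0) (at s)"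
    using eventually_nhds_x_imp_x[OF d] assms(2) by simp
  moreover have "\<forall>\<^sub>F r in at s. \<gamma> differentiable (at r)"
    using at_d by eventually_elim (rule differentiableI_vector)
  moreover have "norm (sgn (w s)) = 1" using w(2) by (simp add: norm_sgn)
  ultimately show ?thesis unfolding cusp_at_def by blast
qed

lemma components_strip_cut:
  fixes a b c :: real
  assumes "a < c" "c < b"
  shows "components ({a<..<b} \<times> UNIV - {c} \<times> UNIV :: (real \<times> real) set)
    = {{a<..<c} \<times> UNIV, {c<..<b} \<times> UNIV}"
proof (rule components_open_unique)
  show "pairwise disjnt {{a<..<c} \<times> UNIV, {c<..<b} \<times> (UNIV :: real set)}"
    by (auto simp: pairwise_def disjnt_def)
  show "\<Union> {{a<..<c} \<times> UNIV, {c<..<b} \<times> UNIV} = {a<..<b} \<times> UNIV - {c} \<times> (UNIV :: real set)"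
    using assms by auto
  show "open X \<and> connected X \<and> X \<noteq> {}"
    if "X \<in> {{a<..<c} \<times> UNIV, {c<..<b} \<times> (UNIV :: real set)}" for X
    using that assms by (auto intro!: open_Times connected_Times)
qed

text \<open>Since the direction field is nonzero, a singular point is a zero of the common factor, and
  for positive \<open>k\<close> such a zero exists only when \<open>k < 1\<close>.\<close>

lemma profile_singular_cases:
  assumes "C > 0" "k > 0" "s \<in> I_dom k C" "sk = sqrt ((1 + k) / (1 - k))"
    and z: "(z has_real_derivative deriv (g_fun k C) s / t_fun k C s) (at s)"
    and 0: "(profile k C z has_vector_derivative 0) (at s)"
  shows "s = sk \<and> k < 1"
proof -
  note s = I_domD[OF assms(3)]
  have "h_deriv k C s *\<^sub>R profile_direction k C s = 0"
    using vector_derivative_unique_at[OF profile_has_vector_derivative[OF assms(1-3) z] 0] .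
  then have "h_deriv k C s = 0" using profile_direction_nonzero[OF assms(3)] by simp
  then have "(k - 1) * s\<^sup>2 + 1 + k = 0"
    unfolding h_deriv_def using assms(1) s sum_square_one_pos[of s] by simp
  then have e: "(1 - k) * s\<^sup>2 = 1 + k" by (simp add: algebra_simps)
  with assms(2) have "0 < (1 - k) * s\<^sup>2" by simp
  then have k: "k < 1" using s by (simp add: zero_less_mult_iff)
  with e have "s\<^sup>2 = (1 + k) / (1 - k)" by (simp add: field_simps)
  then have "s = sk" unfolding assms(4) using s by (metis less_imp_le real_sqrt_unique)
  with k show ?thesis by simp
qed

lemma profile_cusp:
  assumes "C > 0" "0 < k" "k < 1" "sk = sqrt ((1 + k) / (1 - k))" "sk \<in> I_dom k C"
    and z: "\<forall>s\<in>I_dom k C. (z has_real_derivative deriv (g_fun k C) s / t_fun k C s) (at s)"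
  shows "cusp_at (profile k C z) sk"
proof (rule cusp_atI)
  note sk = turning_point[OF assms(2-4)]
  have ev: "\<forall>\<^sub>F r in nhds sk. r \<in> I_dom k C"
    using open_I_dom assms(5) by (rule eventually_nhds_in_open)
  then show "\<forall>\<^sub>F r in nhds sk. (profile k C z has_vector_derivative
      h_deriv k C r *\<^sub>R profile_direction k C r) (at r)"
    by eventually_elim (use profile_has_vector_derivative[OF assms(1,2)] z in blast)
  show "h_deriv k C sk = 0" using h_deriv_sign(3)[OF assms(1-4)] sk by blast
  have "\<forall>\<^sub>F r in at_left sk. 0 < r \<and> r < sk"
    using eventually_at_left_real[OF sk(1)] by eventually_elim auto
  then show "\<forall>\<^sub>F r in at_left sk. h_deriv k C r > 0"
    by eventually_elim (use h_deriv_sign(1)[OF assms(1-4)] in blast)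
  have "\<forall>\<^sub>F r in at_right sk. sk < r" by (rule eventually_at_right_less)
  then show "\<forall>\<^sub>F r in at_right sk. h_deriv k C r < 0"
    by eventually_elim (use h_deriv_sign(2)[OF assms(1-4)] sk in force)
  show "isCont (profile_direction k C) sk"
    by (rule isCont_profile_direction[OF assms(1,2,5)])
  show "profile_direction k C sk \<noteq> 0" by (rule profile_direction_nonzero[OF assms(5)])
qed

lemma helical_surface_in_closure:
  assumes "isCont \<gamma> s" "F \<le> at s" "F \<noteq> bot" "\<forall>\<^sub>F r in F. r \<in> J"
  shows "helical_surface \<gamma> (s, v) \<in> closure (helical_surface \<gamma> ` (J \<times> UNIV))"
proof (rule Lim_in_closed_set[OF closed_closure _ assms(3)])
  show "((\<lambda>r. helical_surface \<gamma> (r, v)) \<longlongrightarrow> helical_surface \<gamma> (s, v)) F"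
    using helical_surface_continuous[OF assms(1), of v] assms(2)
    unfolding isCont_def by (rule tendsto_mono[rotated])
  show "\<forall>\<^sub>F r in F. helical_surface \<gamma> (r, v) \<in> closure (helical_surface \<gamma> ` (J \<times> UNIV))"
    using assms(4) by eventually_elim (auto intro!: closure_subset[THEN subsetD] imageI)
qed

theorem mainTheorem2:
  fixes a k C sk s0 :: real
    and h t g z :: "real \<Rightarrow> real"
    and I :: "real set"
    and X :: "real \<Rightarrow> real ^ 3"
    and S :: "real \<times> real \<Rightarrow> real ^ 3"
  assumes a: "a \<notin> {0, 1, -1}"
    and k: "k = \<bar>(a - 1) / (a + 1)\<bar>"
    and C: "C > 0"
    and h: "h = h_fun k C"
    and I: "I = I_dom k C" "I \<noteq> {}"
    and g: "g = g_fun k C"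
    and t: "t = t_fun k C"
    and z: "\<forall>s\<in>I. (z has_real_derivative deriv g s / t s) (at s)"
    and X: "X = profile k C z"
    and S: "S = helical_surface X"
    and sk: "sk = sqrt ((1 + k) / (1 - k))"
    and s0: "s0 = Inf I"
  shows
    "(\<forall>s\<in>I. \<forall>v. (k - 1) * s\<^sup>2 + 1 + k \<noteq> 0 \<longrightarrow>
        regular_point S (s, v) \<and> principal_curvature_ratio S (s, v) a) \<and>
     (\<forall>s\<in>I. (h has_real_derivative
        2 * C * s powr k * ((k - 1) * s\<^sup>2 + 1 + k) / (s\<^sup>2 + 1)\<^sup>2) (at s)) \<and>
     (\<forall>s\<in>I. (X has_vector_derivative
        deriv h s *\<^sub>R vector [1 / (4 * t s),
          ((k + 1) * s\<^sup>2 - k + 1) / (8 * k * s * sqrt (h s)),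
          ((k + 1) * s\<^sup>2 - k + 1) / (8 * k * s * t s * sqrt (h s))]) (at s)) \<and>
     (\<exists>w. continuous_on I w \<and>
        (\<forall>s\<in>I. (X has_vector_derivative ((k - 1) * s\<^sup>2 + 1 + k) *\<^sub>R w s) (at s))) \<and>
     (\<forall>s\<in>I. (X has_vector_derivative 0) (at s) \<longrightarrow> s = sk \<and> k < 1) \<and>
     (\<forall>s\<in>I. cusp_at X s \<longrightarrow> s = sk \<and> k < 1) \<and>
     (k < 1 \<longleftrightarrow> a > 0) \<and>
     (a > 0 \<longrightarrow>
        sk \<in> I \<and> cusp_at X sk \<and> (\<forall>s\<in>I. t s \<le> t sk) \<and>
        (\<exists>s0'. s0' > sk \<and> sk > s0 \<and> I = {s0<..<s0'} \<and>
           strict_antimono_on {sk..s0'} t \<and> t s0' = 0) \<and>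
        {p \<in> I \<times> UNIV. singular_point S p} = {sk} \<times> UNIV \<and>
        (let A = {s \<in> I. s < sk} \<times> UNIV;
             B = {s \<in> I. s > sk} \<times> UNIV;
             c = range (\<lambda>v. helical_motion v (X sk))
         in S ` ({sk} \<times> UNIV) = c \<and>
            A \<noteq> B \<and> components (I \<times> UNIV - {sk} \<times> UNIV) = {A, B} \<and>
            S ` (I \<times> UNIV) - c = S ` A \<union> S ` B \<and>
            c \<subseteq> closure (S ` A) \<inter> closure (S ` B)))"
proof -
  note k_ratio = curvature_ratio_parameter[OF a k]
  have k0: "k > 0" and k1: "k \<noteq> 1" using k_ratio by blast+
  note Idef = I(1)
  have zI: "\<forall>s\<in>I_dom k C. (z has_real_derivative deriv (g_fun k C) s / t_fun k C s) (at s)"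
    using z unfolding Idef g t .
  have pos: "s > 0" "h s > 1" "t s > 0" if "s \<in> I" for s
    using I_domD that unfolding Idef h t by blast+
  have dh: "(h has_real_derivative h_deriv k C s) (at s)" if "s \<in> I" for s
    unfolding h using h_fun_has_derivative pos(1)[OF that] by blast
  have dX: "(X has_vector_derivative h_deriv k C s *\<^sub>R profile_direction k C s) (at s)" if "s \<in> I" for s
    unfolding X using profile_has_vector_derivative[OF C k0] zI that unfolding Idef by blast
  have regular: "\<forall>s\<in>I. \<forall>v. (k - 1) * s\<^sup>2 + 1 + k \<noteq> 0 \<longrightarrow>
      regular_point S (s, v) \<and> principal_curvature_ratio S (s, v) a"
    unfolding S X Idef
    using helical_regular_point[OF C k0 k1 _ _ zI] helical_curvature_ratio[OF a k C _ _ zI] by blast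
  have h': "\<forall>s\<in>I. (h has_real_derivative
      2 * C * s powr k * ((k - 1) * s\<^sup>2 + 1 + k) / (s\<^sup>2 + 1)\<^sup>2) (at s)"
    using dh unfolding h_deriv_def by blast
  have X': "\<forall>s\<in>I. (X has_vector_derivative
        deriv h s *\<^sub>R vector [1 / (4 * t s),
          ((k + 1) * s\<^sup>2 - k + 1) / (8 * k * s * sqrt (h s)),
          ((k + 1) * s\<^sup>2 - k + 1) / (8 * k * s * t s * sqrt (h s))]) (at s)"
  proof
    fix s assume s: "s \<in> I"
    have "deriv h s = h_deriv k C s" by (rule DERIV_imp_deriv[OF dh[OF s]])
    moreover have "profile_direction k C s = vector [1 / (4 * t s),
          ((k + 1) * s\<^sup>2 - k + 1) / (8 * k * s * sqrt (h s)),
          ((k + 1) * s\<^sup>2 - k + 1) / (8 * k * s * t s * sqrt (h s))]"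
      unfolding profile_direction_def slope_def h t by (simp add: mult.commute mult.left_commute)
    ultimately show "(X has_vector_derivative
        deriv h s *\<^sub>R vector [1 / (4 * t s),
          ((k + 1) * s\<^sup>2 - k + 1) / (8 * k * s * sqrt (h s)),
          ((k + 1) * s\<^sup>2 - k + 1) / (8 * k * s * t s * sqrt (h s))]) (at s)"
      using dX[OF s] by simp
  qed
  have factor: "\<exists>w. continuous_on I w \<and>
      (\<forall>s\<in>I. (X has_vector_derivative ((k - 1) * s\<^sup>2 + 1 + k) *\<^sub>R w s) (at s))"
  proof (intro exI conjI ballI)
    let ?w = "\<lambda>s. (2 * C * s powr k / (s\<^sup>2 + 1)\<^sup>2) *\<^sub>R profile_direction k C s"
    have "continuous_on I (profile_direction k C)"
      using isCont_profile_direction[OF C k0] unfolding Idef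
      by (intro continuous_at_imp_continuous_on) blast
    moreover have "\<forall>s\<in>I. (s\<^sup>2 + 1)\<^sup>2 \<noteq> 0"
      using sum_square_one_pos by (metis less_irrefl zero_eq_power2)
    ultimately show "continuous_on I ?w"
      using pos(1) by (intro continuous_intros) force+
    show "(X has_vector_derivative ((k - 1) * s\<^sup>2 + 1 + k) *\<^sub>R ?w s) (at s)" if "s \<in> I" for s
      using dX[OF that] by (simp add: h_deriv_def mult.commute mult.left_commute)
  qed
  have sing: "\<forall>s\<in>I. (X has_vector_derivative 0) (at s) \<longrightarrow> s = sk \<and> k < 1"
    unfolding X Idef using profile_singular_cases[OF C k0 _ sk] zI by blast
  then have cusp: "\<forall>s\<in>I. cusp_at X s \<longrightarrow> s = sk \<and> k < 1"
    unfolding cusp_at_def by blast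
  have elliptic: "sk \<in> I \<and> cusp_at X sk \<and> (\<forall>s\<in>I. t s \<le> t sk) \<and>
        (\<exists>s0'. s0' > sk \<and> sk > s0 \<and> I = {s0<..<s0'} \<and>
           strict_antimono_on {sk..s0'} t \<and> t s0' = 0) \<and>
        {p \<in> I \<times> UNIV. singular_point S p} = {sk} \<times> UNIV \<and>
        (let A = {s \<in> I. s < sk} \<times> UNIV;
             B = {s \<in> I. s > sk} \<times> UNIV;
             c = range (\<lambda>v. helical_motion v (X sk))
         in S ` ({sk} \<times> UNIV) = c \<and>
            A \<noteq> B \<and> components (I \<times> UNIV - {sk} \<times> UNIV) = {A, B} \<and>
            S ` (I \<times> UNIV) - c = S ` A \<union> S ` B \<and>
            c \<subseteq> closure (S ` A) \<inter> closure (S ` B))" if "a > 0"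
  proof -
    have k': "k < 1" using that k_ratio(4) by blast
    obtain s1 s2 where s12: "0 < s1" "s1 < sk" "sk < s2" "h_fun k C s2 = 1" and I_eq: "I = {s1<..<s2}"
      using I_dom_interval[OF C k0 k' sk] I(2) unfolding Idef by metis
    have skI: "sk \<in> I" unfolding I_eq using s12 by simp
    have sk0: "sk > 0" using s12 by simp
    have s0_eq: "s0 = s1" unfolding s0 I_eq using s12 by (intro cInf_greaterThanLessThan) simp
    have "\<forall>s\<in>I. t s \<le> t sk"
      using h_fun_le_max[OF C k0 k' sk] pos(1) unfolding t t_fun_def by simp
    moreover have "strict_antimono_on {sk..s2} t"
      using h_fun_unimodal(2)[OF C k0 k' sk] sk0
      by (auto simp: t t_fun_def monotone_on_def)
    moreover have "t s2 = 0" using s12 by (simp add: t t_fun_def)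
    moreover have "cusp_at X sk"
      unfolding X using profile_cusp[OF C k0 k' sk _ zI] skI unfolding Idef by blast
    moreover have "{p \<in> I \<times> UNIV. singular_point S p} = {sk} \<times> UNIV"
    proof -
      have "singular_point S (sk, v)" for v
        unfolding S using \<open>cusp_at X sk\<close> helical_surface_singular_point
        by (auto simp: cusp_at_def)
      then have "{sk} \<times> UNIV \<subseteq> {p \<in> I \<times> UNIV. singular_point S p}"
        using skI by blast
      moreover have "s = sk" if s: "s \<in> I" "singular_point S (s, v)" for s v
      proof -
        have "(k - 1) * s\<^sup>2 + 1 + k = 0"
          using regular regular_point_not_singular s by blast
        then have "s\<^sup>2 = sk\<^sup>2"
          using turning_point(2)[OF k0 k' sk, of s] k' by simp
        then show ?thesis using pos(1)[OF s(1)] sk0 by (simp add: power2_eq_iff)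
      qed
      then have "{p \<in> I \<times> UNIV. singular_point S p} \<subseteq> {sk} \<times> UNIV" by blast
      ultimately show ?thesis by blast
    qed
    moreover have "let A = {s \<in> I. s < sk} \<times> UNIV;
             B = {s \<in> I. s > sk} \<times> UNIV;
             c = range (\<lambda>v. helical_motion v (X sk))
         in S ` ({sk} \<times> UNIV) = c \<and>
            A \<noteq> B \<and> components (I \<times> UNIV - {sk} \<times> UNIV) = {A, B} \<and>
            S ` (I \<times> UNIV) - c = S ` A \<union> S ` B \<and>
            c \<subseteq> closure (S ` A) \<inter> closure (S ` B)"
      unfolding Let_def
    proof (intro conjI)
      let ?JA = "{s \<in> I. s < sk}" and ?JB = "{s \<in> I. s > sk}"
      let ?A = "?JA \<times> (UNIV :: real set)" and ?B = "?JB \<times> (UNIV :: real set)"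
      let ?c = "range (\<lambda>v. helical_motion v (X sk))"
      have J: "?JA = {s1<..<sk}" "?JB = {sk<..<s2}" unfolding I_eq using s12 by auto
      show c: "S ` ({sk} \<times> UNIV) = ?c"
        by (simp add: S helical_surface_def image_def)
      have "?JA \<noteq> {}" unfolding J using s12 by simp
      then show "?A \<noteq> ?B" by force
      show "components (I \<times> UNIV - {sk} \<times> UNIV) = {?A, ?B}"
        unfolding J unfolding I_eq using s12 by (intro components_strip_cut)
      have sq: "(X s $ 1)\<^sup>2 + (X s $ 2)\<^sup>2 = (h_fun k C s - 1) / 4 + (g_fun k C s)\<^sup>2" if "s \<in> I" for s
        using h_fun_eq_t_fun[of s k C] that unfolding Idef X profile_def
        by (simp add: power_divide)
      have "S (s, v) \<notin> ?c" if "s \<in> I" "s \<noteq> sk" for s v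
      proof
        assume "S (s, v) \<in> ?c"
        then obtain u where "helical_motion v (X s) = helical_motion u (X sk)"
          unfolding S helical_surface_def by auto
        then have "(X s $ 1)\<^sup>2 + (X s $ 2)\<^sup>2 = (X sk $ 1)\<^sup>2 + (X sk $ 2)\<^sup>2"
          by (metis helical_motion_axis_distance)
        with profile_axis_distance_minimal[OF C k0 k' sk pos(1)[OF that(1)] that(2)]
        show False unfolding sq[OF that(1)] sq[OF skI] by simp
      qed
      then have "S ` ?A \<inter> ?c = {}" "S ` ?B \<inter> ?c = {}" by fastforce+
      moreover have "S ` (I \<times> UNIV) = S ` ?A \<union> S ` ?B \<union> ?c"
      proof -
        have "I \<times> (UNIV :: real set) = ?A \<union> ?B \<union> {sk} \<times> UNIV" using skI by auto
        then show ?thesis unfolding c[symmetric] by (metis image_Un)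
      qed
      ultimately show "S ` (I \<times> UNIV) - ?c = S ` ?A \<union> S ` ?B" by blast
      have cont: "isCont X sk" using has_vector_derivative_continuous[OF dX[OF skI]] .
      have "\<forall>\<^sub>F r in at_left sk. r \<in> ?JA" "\<forall>\<^sub>F r in at_right sk. r \<in> ?JB"
        unfolding J by (rule eventually_at_left_real[OF s12(2)] eventually_at_right_real[OF s12(3)])+
      then have "S (sk, v) \<in> closure (S ` ?A) \<inter> closure (S ` ?B)" for v
        unfolding S
        using helical_surface_in_closure[OF cont, of "at_left sk"]
          helical_surface_in_closure[OF cont, of "at_right sk"]
        by (simp add: at_le)
      then show "?c \<subseteq> closure (S ` ?A) \<inter> closure (S ` ?B)"
        unfolding c[symmetric] by blast
    qed
    ultimately show ?thesis using skI s12 I_eq s0_eq by blast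
  qed
  show ?thesis
    using regular h' X' factor sing cusp k_ratio(4) elliptic by blast
qed

end
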